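(* Let $\alpha\ge 0$ be real and $d,k,\gamma>0$. The free boundary problems (P1) (convective condition) and (P2) (temperature condition) described in the context are equivalent, in the following sense. (a) Let $h_0,T_\infty>0$ be data of problem (P1), with solution $(\Psi,s)$, $s(t)=2\nu\sqrt{dt}$. If the datum $T_0$ of problem (P2) is given by $$T_0=\frac{2\sqrt d\,h_0T_\infty\,\nu M\left(-\frac{\alpha}{2}+\frac12,\frac32,-\nu^2\right)}{kM\left(-\frac{\alpha}{2},\frac12,-\nu^2\right)+2\sqrt d\,h_0\,\nu M\left(-\frac{\alpha}{2}+\frac12,\frac32,-\nu^2\right)},$$ then the solution $(\Theta,r)$ of (P2) with this $T_0$ coincides with the solution of (P1): $\Theta=\Psi$ and $r=s$. (b) Let $T_0>0$ be the datum of problem (P2), with solution $(\Theta,r)$, $r(t)=2\mu\sqrt{dt}$. If the data $T_\infty,h_0$ of problem (P1) satisfy $T_\infty>T_0$ and $$h_0=\frac{-kT_0M\left(-\frac{\alpha}{2},\frac12,-\mu^2\right)}{2\sqrt d\,(T_0-T_\infty)\,\mu M\left(-\frac{\alpha}{2}+\frac12,\frac32,-\mu^2\right)},$$ then the solution $(\Psi,s)$ of (P1) with these $h_0,T_\infty$ coincides with the solution of (P2): $\Psi=\Theta$ and $s=r$.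
   Context: $M(a,b,z)$ is the Kummer function $M(a,b,z)=\sum_{j=0}^{\infty}\frac{(a)_j}{(b)_j\,j!}z^j$, where $(a)_0=1$ and $(a)_j=a(a+1)\cdots(a+j-1)$. Throughout $\eta=x/(2\sqrt{dt})$. Problem (P1), with data $h_0>0$, $T_\infty>0$: find $\Psi(x,t)$ and $s(t)$ with $\Psi_t=d\Psi_{xx}$ for $0<x<s(t)$, $t>0$; $s(0)=0$; and, for $t>0$, $\Psi(s(t),t)=0$, $k\Psi_x(0,t)=h_0t^{-1/2}[\Psi(0,t)-T_\infty t^{\alpha/2}]$, $k\Psi_x(s(t),t)=-\gamma s(t)^\alpha\dot s(t)$. Its (similarity) solution is $$\Psi(x,t)=t^{\alpha/2}\left[c_{11}M\left(-\tfrac{\alpha}{2},\tfrac12,-\eta^2\right)+c_{21}\eta M\left(-\tfrac{\alpha}{2}+\tfrac12,\tfrac32,-\eta^2\right)\right],\quad s(t)=2\nu\sqrt{dt},$$ $$c_{11}=\frac{-\nu M\left(-\frac{\alpha}{2}+\frac12,\frac32,-\nu^2\right)}{M\left(-\frac{\alpha}{2},\frac12,-\nu^2\right)}c_{21},\quad c_{21}=\frac{-2h_0\sqrt d\,T_\infty M\left(-\frac{\alpha}{2},\frac12,-\nu^2\right)}{kM\left(-\frac{\alpha}{2},\frac12,-\nu^2\right)+2\sqrt d\,h_0\nu M\left(-\frac{\alpha}{2}+\frac12,\frac32,-\nu^2\right)},$$ where $\nu$ is the unique positive solution of $\frac{h_0T_\infty}{\gamma2^\alpha d^{(\alpha+1)/2}}f_1(x)=x^{\alpha+1}$,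 $x>0$, with $f_1(x)=\left[M\left(\frac{\alpha}{2}+\frac12,\frac12,x^2\right)+2\frac{\sqrt d\,h_0}{k}xM\left(\frac{\alpha}{2}+1,\frac32,x^2\right)\right]^{-1}$. Problem (P2), with datum $T_0>0$: find $\Theta(x,t)$ and $r(t)$ with $\Theta_t=d\Theta_{xx}$ for $0<x<r(t)$, $t>0$; $r(0)=0$; and, for $t>0$, $\Theta(r(t),t)=0$, $\Theta(0,t)=T_0t^{\alpha/2}$, $k\Theta_x(r(t),t)=-\gamma r(t)^\alpha\dot r(t)$. Its (similarity) solution is $$\Theta(x,t)=t^{\alpha/2}\left[c_{12}M\left(-\tfrac{\alpha}{2},\tfrac12,-\eta^2\right)+c_{22}\eta M\left(-\tfrac{\alpha}{2}+\tfrac12,\tfrac32,-\eta^2\right)\right],\quad r(t)=2\mu\sqrt{dt},$$ $$c_{12}=T_0,\qquad c_{22}=\frac{-T_0M\left(-\frac{\alpha}{2},\frac12,-\mu^2\right)}{\mu M\left(-\frac{\alpha}{2}+\frac12,\frac32,-\mu^2\right)},$$ where $\mu$ is the unique positive solution of $\frac{kT_0}{2^{\alpha+1}d^{\alpha/2+1}\gamma}f_2(x)=x^{\alpha+1}$, $x>0$, with $f_2(x)=\left[xM\left(\frac{\alpha}{2}+1,\frac32,x^2\right)\right]^{-1}$. *)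

theory Defs
  imports Complex_Main
begin

text \<open>The Kummer function \<open>M(a, b, z)\<close>; the series converges for every \<open>z\<close> unless \<open>b\<close> is a
  nonpositive integer (only \<open>b = 1/2\<close> and \<open>b = 3/2\<close> occur below).\<close>

definition kummer :: "real \<Rightarrow> real \<Rightarrow> real \<Rightarrow> real" where
  "kummer a b z = (\<Sum>j. pochhammer a j / (pochhammer b j * fact j) * z ^ j)"


subsection \<open>The free boundary problems\<close>

text \<open>A field \<open>u\<close> is a function of \<open>x\<close> and \<open>t\<close>, in this order; only its values for \<open>t > 0\<close> and
  \<open>0 \<le> x \<le> s t\<close> matter.\<close>

definition heat_equation_on :: "real \<Rightarrow> (real \<Rightarrow> real \<Rightarrow> real) \<Rightarrow> (real \<Rightarrow> real) \<Rightarrow> bool" where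
  "heat_equation_on d u s \<longleftrightarrow>
     (\<exists>u\<^sub>x u\<^sub>x\<^sub>x u\<^sub>t. \<forall>t>0. \<forall>x. 0 < x \<and> x < s t \<longrightarrow>
        ((\<lambda>y. u y t) has_real_derivative u\<^sub>x x t) (at x) \<and>
        ((\<lambda>y. u\<^sub>x y t) has_real_derivative u\<^sub>x\<^sub>x x t) (at x) \<and>
        ((\<lambda>\<tau>. u x \<tau>) has_real_derivative u\<^sub>t x t) (at t) \<and>
        u\<^sub>t x t = d * u\<^sub>x\<^sub>x x t)"

text \<open>The Stefan condition \<open>k u\<^sub>x(s(t), t) = - \<gamma> s(t)\<^sup>\<alpha> s'(t)\<close>. Spatial derivatives at the two
  ends of \<open>[0, s t]\<close> are one-sided, since \<open>u\<close> is only meaningful there.\<close>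

definition stefan_condition ::
    "real \<Rightarrow> real \<Rightarrow> real \<Rightarrow> (real \<Rightarrow> real \<Rightarrow> real) \<Rightarrow> (real \<Rightarrow> real) \<Rightarrow> real \<Rightarrow> bool" where
  "stefan_condition \<alpha> k \<gamma> u s t \<longleftrightarrow>
     (\<exists>p v. ((\<lambda>x. u x t) has_real_derivative p) (at (s t) within {0..s t}) \<and>
            (s has_real_derivative v) (at t) \<and>
            k * p = - \<gamma> * s t powr \<alpha> * v)"

definition solves_P1 :: "real \<Rightarrow> real \<Rightarrow> real \<Rightarrow> real \<Rightarrow> real \<Rightarrow> real \<Rightarrow>
    (real \<Rightarrow> real \<Rightarrow> real) \<Rightarrow> (real \<Rightarrow> real) \<Rightarrow> bool" where
  "solves_P1 \<alpha> d k \<gamma> h\<^sub>0 T_inf \<Psi> s \<longleftrightarrow>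
     h\<^sub>0 > 0 \<and> T_inf > 0 \<and> s 0 = 0 \<and> (\<forall>t>0. s t > 0) \<and>
     heat_equation_on d \<Psi> s \<and>
     (\<forall>t>0. \<Psi> (s t) t = 0 \<and>
            (\<exists>p. ((\<lambda>x. \<Psi> x t) has_real_derivative p) (at 0 within {0..s t}) \<and>
                 k * p = h\<^sub>0 * t powr (- 1 / 2) * (\<Psi> 0 t - T_inf * t powr (\<alpha> / 2))) \<and>
            stefan_condition \<alpha> k \<gamma> \<Psi> s t)"

definition solves_P2 :: "real \<Rightarrow> real \<Rightarrow> real \<Rightarrow> real \<Rightarrow> real \<Rightarrow>
    (real \<Rightarrow> real \<Rightarrow> real) \<Rightarrow> (real \<Rightarrow> real) \<Rightarrow> bool" where
  "solves_P2 \<alpha> d k \<gamma> T\<^sub>0 \<Theta> r \<longleftrightarrow>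
     T\<^sub>0 > 0 \<and> r 0 = 0 \<and> (\<forall>t>0. r t > 0) \<and>
     heat_equation_on d \<Theta> r \<and>
     (\<forall>t>0. \<Theta> (r t) t = 0 \<and>
            \<Theta> 0 t = T\<^sub>0 * t powr (\<alpha> / 2) \<and>
            stefan_condition \<alpha> k \<gamma> \<Theta> r t)"


subsection \<open>The similarity solutions\<close>

text \<open>Here \<open>x / (2 * sqrt (d * t))\<close> is the similarity variable \<open>\<eta>\<close>.\<close>

definition similarity_field :: "real \<Rightarrow> real \<Rightarrow> real \<Rightarrow> real \<Rightarrow> real \<Rightarrow> real \<Rightarrow> real" where
  "similarity_field \<alpha> d c\<^sub>1 c\<^sub>2 x t =
     (let \<eta> = x / (2 * sqrt (d * t)) in
      t powr (\<alpha> / 2) *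
        (c\<^sub>1 * kummer (- \<alpha> / 2) (1/2) (- (\<eta>\<^sup>2)) +
         c\<^sub>2 * \<eta> * kummer (- \<alpha> / 2 + 1/2) (3/2) (- (\<eta>\<^sup>2))))"

definition f\<^sub>1 :: "real \<Rightarrow> real \<Rightarrow> real \<Rightarrow> real \<Rightarrow> real \<Rightarrow> real" where
  "f\<^sub>1 \<alpha> d k h\<^sub>0 x =
     inverse (kummer (\<alpha> / 2 + 1/2) (1/2) (x\<^sup>2) +
              2 * (sqrt d * h\<^sub>0 / k) * x * kummer (\<alpha> / 2 + 1) (3/2) (x\<^sup>2))"

definition f\<^sub>2 :: "real \<Rightarrow> real \<Rightarrow> real" where
  "f\<^sub>2 \<alpha> x = inverse (x * kummer (\<alpha> / 2 + 1) (3/2) (x\<^sup>2))"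

definition nu_P1 :: "real \<Rightarrow> real \<Rightarrow> real \<Rightarrow> real \<Rightarrow> real \<Rightarrow> real \<Rightarrow> real" where
  "nu_P1 \<alpha> d k \<gamma> h\<^sub>0 T_inf =
     (THE x. x > 0 \<and>
        h\<^sub>0 * T_inf / (\<gamma> * 2 powr \<alpha> * d powr ((\<alpha> + 1) / 2)) * f\<^sub>1 \<alpha> d k h\<^sub>0 x = x powr (\<alpha> + 1))"

definition mu_P2 :: "real \<Rightarrow> real \<Rightarrow> real \<Rightarrow> real \<Rightarrow> real \<Rightarrow> real" where
  "mu_P2 \<alpha> d k \<gamma> T\<^sub>0 =
     (THE x. x > 0 \<and>
        k * T\<^sub>0 / (2 powr (\<alpha> + 1) * d powr (\<alpha> / 2 + 1) * \<gamma>) * f\<^sub>2 \<alpha> x = x powr (\<alpha> + 1))"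

definition s_P1 :: "real \<Rightarrow> real \<Rightarrow> real \<Rightarrow> real \<Rightarrow> real \<Rightarrow> real \<Rightarrow> real \<Rightarrow> real" where
  "s_P1 \<alpha> d k \<gamma> h\<^sub>0 T_inf t = 2 * nu_P1 \<alpha> d k \<gamma> h\<^sub>0 T_inf * sqrt (d * t)"

definition Psi_P1 :: "real \<Rightarrow> real \<Rightarrow> real \<Rightarrow> real \<Rightarrow> real \<Rightarrow> real \<Rightarrow> real \<Rightarrow> real \<Rightarrow> real" where
  "Psi_P1 \<alpha> d k \<gamma> h\<^sub>0 T_inf =
     (let \<nu> = nu_P1 \<alpha> d k \<gamma> h\<^sub>0 T_inf;
          A = kummer (- \<alpha> / 2) (1/2) (- (\<nu>\<^sup>2));
          B = kummer (- \<alpha> / 2 + 1/2) (3/2) (- (\<nu>\<^sup>2));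
          c\<^sub>2\<^sub>1 = - 2 * h\<^sub>0 * sqrt d * T_inf * A / (k * A + 2 * sqrt d * h\<^sub>0 * \<nu> * B);
          c\<^sub>1\<^sub>1 = - \<nu> * B / A * c\<^sub>2\<^sub>1
      in similarity_field \<alpha> d c\<^sub>1\<^sub>1 c\<^sub>2\<^sub>1)"

definition r_P2 :: "real \<Rightarrow> real \<Rightarrow> real \<Rightarrow> real \<Rightarrow> real \<Rightarrow> real \<Rightarrow> real" where
  "r_P2 \<alpha> d k \<gamma> T\<^sub>0 t = 2 * mu_P2 \<alpha> d k \<gamma> T\<^sub>0 * sqrt (d * t)"

definition Theta_P2 :: "real \<Rightarrow> real \<Rightarrow> real \<Rightarrow> real \<Rightarrow> real \<Rightarrow> real \<Rightarrow> real \<Rightarrow> real" where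
  "Theta_P2 \<alpha> d k \<gamma> T\<^sub>0 =
     (let \<mu> = mu_P2 \<alpha> d k \<gamma> T\<^sub>0;
          A = kummer (- \<alpha> / 2) (1/2) (- (\<mu>\<^sup>2));
          B = kummer (- \<alpha> / 2 + 1/2) (3/2) (- (\<mu>\<^sup>2));
          c\<^sub>1\<^sub>2 = T\<^sub>0;
          c\<^sub>2\<^sub>2 = - T\<^sub>0 * A / (\<mu> * B)
      in similarity_field \<alpha> d c\<^sub>1\<^sub>2 c\<^sub>2\<^sub>2)"

text \<open>Two pairs (field, free boundary) coincide: the boundaries agree for \<open>t \<ge> 0\<close>, and the fields
  agree on their common domain \<open>0 \<le> x \<le> s t\<close>, \<open>t > 0\<close>.\<close>

definition solutions_coincide :: "(real \<Rightarrow> real \<Rightarrow> real) \<Rightarrow> (real \<Rightarrow> real) \<Rightarrow>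
    (real \<Rightarrow> real \<Rightarrow> real) \<Rightarrow> (real \<Rightarrow> real) \<Rightarrow> bool" where
  "solutions_coincide u s v r \<longleftrightarrow>
     (\<forall>t\<ge>0. r t = s t) \<and> (\<forall>t>0. \<forall>x\<in>{0..s t}. v x t = u x t)"

end

theory Submission
  imports Defs
begin

text \<open>Write \<open>P(x) = M(\<alpha>/2 + 1/2, 1/2, x\<^sup>2)\<close>, \<open>Q(x) = x M(\<alpha>/2 + 1, 3/2, x\<^sup>2)\<close> and
  \<open>L(\<nu>) = \<gamma> 2\<^bsup>\<alpha>+1\<^esup> d\<^bsup>\<alpha>/2+1\<^esup> \<nu>\<^bsup>\<alpha>+1\<^esup>\<close>. Both problems have the same heat equation and the same Stefan
  condition, so they share the one-parameter family of self-similar solutions with front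
  \<open>2 \<nu> sqrt (d t)\<close>, \<open>\<nu> > 0\<close>. In such a solution the profile \<open>y(\<eta>)\<close> solves
  \<open>y'' = - 2 \<eta> y' + 2 \<alpha> y\<close>, vanishes at \<open>\<nu>\<close>, and has \<open>k y'(\<nu>) = - L(\<nu>)\<close> by the Stefan
  condition. These two values at \<open>\<nu>\<close> determine it. The Wronskian of two solutions is a multiple
  of \<open>exp (- \<eta>\<^sup>2)\<close>, and the Kummer transformation turns the two basic solutions into
  \<open>exp (- \<eta>\<^sup>2) P\<close> and \<open>exp (- \<eta>\<^sup>2) Q\<close>; from this \<open>y(0) = L(\<nu>) Q(\<nu>) / k\<close> and
  \<open>y'(0) = - L(\<nu>) P(\<nu>) / k\<close> (\<open>front_profile\<close>).

  What remains of either problem is its condition at \<open>x = 0\<close>, which is a relation between the data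
  and \<open>\<nu>\<close> alone. The temperature condition is \<open>T\<^sub>0 = y(0)\<close>, and the convective condition is
  \<open>2 sqrt d h\<^sub>0 (T\<^sub>\<infinity> - y(0)) = - k y'(0)\<close>. After division these are exactly the transcendental equations
  that define \<open>\<mu>\<close> and \<open>\<nu>\<close> (\<open>mu_P2_iff\<close>, \<open>nu_P1_iff\<close>); each has a unique positive root since
  \<open>P\<close> and \<open>Q\<close> are positive and increasing.

  Hence the two solutions coincide as soon as the two front parameters do
  (\<open>problems_share_front\<close>). The formula for \<open>T\<^sub>0\<close> in (a) is the surface temperature \<open>y(0)\<close> of the
  solution of (P1), so \<open>\<nu>\<close> solves the equation for \<open>\<mu>\<close>; the formula for \<open>h\<^sub>0\<close> in (b) is the
  convective condition for the solution of (P2), solved for \<open>h\<^sub>0\<close>, so \<open>\<mu>\<close> solves the equation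
  for \<open>\<nu>\<close>. The hypothesis \<open>T\<^sub>\<infinity> > T\<^sub>0\<close> makes this \<open>h\<^sub>0\<close> positive.\<close>


section \<open>The Kummer function and its differential equation\<close>

definition kummer_coeff :: "real \<Rightarrow> real \<Rightarrow> nat \<Rightarrow> real" where
  "kummer_coeff a b j = pochhammer a j / (pochhammer b j * fact j)"

lemma kummer_eq: "kummer a b z = (\<Sum>j. kummer_coeff a b j * z ^ j)"
  by (simp add: kummer_def kummer_coeff_def)

lemma kummer_coeff_Suc:
  assumes "b > 0"
  shows "real (Suc j) * (b + real j) * kummer_coeff a b (Suc j) = (a + real j) * kummer_coeff a b j"
proof -
  have "pochhammer b j > 0" "b + real j > 0"
    using assms by (auto simp: pochhammer_pos)
  then show ?thesis
    by (simp add: kummer_coeff_def pochhammer_Suc divide_simps)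
qed

text \<open>The quotient of consecutive Pochhammer factors \<open>\<bar>a + j\<bar> / (b + j)\<close> is bounded by
  \<open>C = \<bar>a\<bar> / b + 1\<close>, so the exponential series of \<open>C \<bar>z\<bar>\<close> is a majorant.\<close>
lemma summable_kummer:
  assumes "b > 0"
  shows "summable (\<lambda>j. kummer_coeff a b j * z ^ j)"
proof -
  define C where "C = \<bar>a\<bar> / b + 1"
  have bound: "\<bar>pochhammer a j / pochhammer b j\<bar> \<le> C ^ j" for j
  proof (induction j)
    case (Suc j)
    have pos: "b + real j > 0"
      using assms by simp
    have "\<bar>a\<bar> \<le> \<bar>a\<bar> / b * (b + real j)"
      using assms by (simp add: field_simps)
    then have "\<bar>a + real j\<bar> \<le> C * (b + real j)"
      using assms unfolding C_def by (simp add: distrib_right)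
    then have step: "\<bar>(a + real j) / (b + real j)\<bar> \<le> C"
      using pos by (simp add: abs_divide divide_le_eq)
    have "\<bar>pochhammer a (Suc j) / pochhammer b (Suc j)\<bar> =
        \<bar>pochhammer a j / pochhammer b j\<bar> * \<bar>(a + real j) / (b + real j)\<bar>"
      by (simp add: pochhammer_Suc abs_mult abs_divide)
    also have "\<dots> \<le> C ^ j * C"
      using Suc.IH step by (intro mult_mono) (auto simp: C_def assms less_imp_le)
    finally show ?case by (simp add: mult.commute)
  qed simp
  show ?thesis
  proof (rule summable_comparison_test')
    show "summable (\<lambda>j. (C * \<bar>z\<bar>) ^ j /\<^sub>R fact j)"
      using summable_exp_generic .
    fix j :: nat
    have "norm (kummer_coeff a b j * z ^ j) =
        \<bar>pochhammer a j / pochhammer b j\<bar> * (\<bar>z\<bar> ^ j / fact j)"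
      by (simp add: kummer_coeff_def abs_mult abs_divide power_abs)
    also have "\<dots> \<le> C ^ j * (\<bar>z\<bar> ^ j / fact j)"
      by (intro mult_right_mono bound) simp
    finally show "norm (kummer_coeff a b j * z ^ j) \<le> (C * \<bar>z\<bar>) ^ j /\<^sub>R fact j"
      by (simp add: power_mult_distrib field_simps)
  qed
qed

lemma diffs_kummer_coeff:
  assumes "b > 0"
  shows "diffs (kummer_coeff a b) j = a / b * kummer_coeff (a + 1) (b + 1) j"
proof -
  have "pochhammer (b + 1) j > 0"
    using assms by (simp add: pochhammer_pos)
  then show ?thesis
    using assms by (simp add: diffs_def kummer_coeff_def pochhammer_rec divide_simps)
qed

lemma diffs_kummer_sums:
  assumes "b > 0"
  shows "(\<lambda>j. diffs (kummer_coeff a b) j * z ^ j) sums (a / b * kummer (a + 1) (b + 1) z)"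
proof -
  have "(\<lambda>j. kummer_coeff (a + 1) (b + 1) j * z ^ j) sums kummer (a + 1) (b + 1) z"
    unfolding kummer_eq using assms by (intro summable_sums summable_kummer) simp
  from sums_mult[OF this, of "a / b"] show ?thesis
    using assms by (simp add: diffs_kummer_coeff mult.assoc)
qed

lemma kummer_has_derivative:
  assumes "b > 0"
  shows "(kummer a b has_real_derivative a / b * kummer (a + 1) (b + 1) z) (at z)"
proof -
  have "kummer a b = (\<lambda>x. \<Sum>j. kummer_coeff a b j * x ^ j)"
    by (simp add: kummer_eq fun_eq_iff)
  then show ?thesis
    using termdiffs_strong_converges_everywhere[OF summable_kummer[OF assms], of a z]
    by (simp add: sums_unique[OF diffs_kummer_sums[OF assms], symmetric])
qed

lemma kummer_square_has_derivative:
  assumes "b > 0"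
  shows "((\<lambda>x. kummer a b (\<sigma> * x\<^sup>2)) has_real_derivative
      2 * \<sigma> * x * (a / b * kummer (a + 1) (b + 1) (\<sigma> * x\<^sup>2))) (at x)"
proof -
  have "((\<lambda>x. \<sigma> * x\<^sup>2) has_real_derivative 2 * \<sigma> * x) (at x)"
    by (auto intro!: derivative_eq_intros)
  from DERIV_chain2[OF kummer_has_derivative[OF assms] this] show ?thesis
    by (simp add: mult.commute)
qed

text \<open>Comparing coefficients of \<open>z\<^sup>j\<close>, with \<open>c\<^sub>j\<close> those of the Kummer series, reduces the equation to
  \<open>(j + 1) (b + j) c\<^sub>j\<^sub>+\<^sub>1 = (a + j) c\<^sub>j\<close>. The derivatives appear in contiguous form, as
  \<open>kummer_has_derivative\<close> produces them.\<close>
lemma kummer_equation: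
  fixes a b z :: real
  assumes "b > 0"
  defines "M' \<equiv> a / b * kummer (a + 1) (b + 1) z"
  defines "M'' \<equiv> a / b * ((a + 1) / (b + 1) * kummer (a + 2) (b + 2) z)"
  shows "z * M'' + (b - z) * M' = a * kummer a b z"
proof -
  let ?c = "kummer_coeff a b"
  have M': "(\<lambda>j. diffs ?c j * z ^ j) sums M'"
    unfolding M'_def by (rule diffs_kummer_sums[OF assms(1)])
  have "diffs (diffs ?c) = (\<lambda>j. a / b * diffs (kummer_coeff (a + 1) (b + 1)) j)"
    using diffs_kummer_coeff[OF assms(1)] by (simp add: diffs_def fun_eq_iff)
  then have "(\<lambda>j. diffs (diffs ?c) j * z ^ j) sums M''"
    using sums_mult[OF diffs_kummer_sums[of "b + 1" "a + 1" z], of "a / b"] assms(1)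
    by (simp add: M''_def mult.assoc add.assoc)
  then have "(\<lambda>j. real (Suc j) * diffs ?c (Suc j) * z ^ j) sums M''"
    by (simp add: diffs_def[of "diffs ?c"])
  from sums_mult[OF this, of z]
  have "(\<lambda>j. real (Suc j) * diffs ?c (Suc j) * z ^ Suc j) sums (z * M'')"
    by (simp add: algebra_simps)
  then have zM'': "(\<lambda>j. real j * diffs ?c j * z ^ j) sums (z * M'')"
    by (subst (asm) sums_Suc_iff) simp
  have "(\<lambda>j. real (Suc j) * ?c (Suc j) * z ^ Suc j) sums (z * M')"
    using sums_mult[OF M', of z] by (simp add: diffs_def algebra_simps)
  then have zM': "(\<lambda>j. real j * ?c j * z ^ j) sums (z * M')"
    by (subst (asm) sums_Suc_iff) simp
  have aM: "(\<lambda>j. a * (?c j * z ^ j)) sums (a * kummer a b z)"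
    using sums_mult[OF summable_sums[OF summable_kummer[OF assms(1)]]] by (simp add: kummer_eq)
  \<comment> \<open>Both sides of \<open>z M'' + b M' = a M + z M'\<close> now have the same power series.\<close>
  have "(\<lambda>j. real j * diffs ?c j * z ^ j + b * (diffs ?c j * z ^ j)) =
      (\<lambda>j. a * (?c j * z ^ j) + real j * ?c j * z ^ j)"
  proof
    fix j
    have "(real j + b) * diffs ?c j = (a + real j) * ?c j"
      using kummer_coeff_Suc[OF assms(1), of j a] by (simp add: diffs_def algebra_simps)
    then have "(real j + b) * diffs ?c j * z ^ j = (a + real j) * ?c j * z ^ j"
      by simp
    then show "real j * diffs ?c j * z ^ j + b * (diffs ?c j * z ^ j) =
        a * (?c j * z ^ j) + real j * ?c j * z ^ j"
      by (simp add: algebra_simps)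
  qed
  then have "z * M'' + b * M' = a * kummer a b z + z * M'"
    using sums_add[OF zM'' sums_mult[OF M', of b]] sums_add[OF aM zM'] by (simp add: sums_unique2)
  then show ?thesis
    by (simp add: algebra_simps)
qed

lemma kummer_0 [simp]: "kummer a b 0 = 1"
  unfolding kummer_eq powser_zero by (simp add: kummer_coeff_def)

lemma kummer_mono:
  assumes "a \<ge> 0" "b > 0" "0 \<le> z" "z \<le> w"
  shows "kummer a b z \<le> kummer a b w"
  unfolding kummer_eq
proof (rule suminf_le)
  fix j
  have "kummer_coeff a b j \<ge> 0"
    using assms pochhammer_pos[of b j] by (cases "a = 0")
      (auto simp: kummer_coeff_def pochhammer_0_left pochhammer_pos less_imp_le)
  then show "kummer_coeff a b j * z ^ j \<le> kummer_coeff a b j * w ^ j"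
    using assms by (intro mult_left_mono power_mono)
qed (use assms in \<open>auto intro: summable_kummer\<close>)

lemma kummer_ge_1:
  assumes "a \<ge> 0" "b > 0" "z \<ge> 0"
  shows "kummer a b z \<ge> 1"
  using kummer_mono[of a b 0 z] assms by simp


section \<open>The profile equation\<close>

text \<open>The equation \<open>y'' = p x y' + q y\<close> of Hermite type. The profiles of self-similar solutions of the
  heat equation satisfy it with \<open>p = - 2\<close>, \<open>q = 2 \<alpha>\<close>; multiplying them by \<open>exp (x\<^sup>2)\<close> leads to
  \<open>p = 2\<close>, \<open>q = 2 \<alpha> + 2\<close>. The derivative is an explicit argument, so that the initial values can be
  read off directly.\<close>
definition hermite_ode :: "real \<Rightarrow> real \<Rightarrow> (real \<Rightarrow> real) \<Rightarrow> (real \<Rightarrow> real) \<Rightarrow> bool" where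
  "hermite_ode p q y y' \<longleftrightarrow>
     (\<forall>x. (y has_real_derivative y' x) (at x) \<and>
          (y' has_real_derivative p * x * y' x + q * y x) (at x))"

lemma hermite_odeD:
  assumes "hermite_ode p q y y'"
  shows "(y has_real_derivative y' x) (at x)"
    and "(y' has_real_derivative p * x * y' x + q * y x) (at x)"
  using assms by (auto simp: hermite_ode_def)

lemma hermite_ode_combination:
  assumes "hermite_ode p q y y'" "hermite_ode p q w w'"
  shows "hermite_ode p q (\<lambda>x. m * y x + n * w x) (\<lambda>x. m * y' x + n * w' x)"
  unfolding hermite_ode_def
  by (auto intro!: derivative_eq_intros hermite_odeD[OF assms(1)] hermite_odeD[OF assms(2)]
      simp: algebra_simps)

text \<open>Under \<open>z = \<sigma> x\<^sup>2\<close> the Kummer equation with \<open>b = 1/2\<close> becomes an equation of Hermite type. The sign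
  \<open>\<sigma> = - 1\<close> gives the profiles themselves, \<open>\<sigma> = 1\<close> their growing counterparts.\<close>
lemma even_kummer_ode:
  "hermite_ode (2 * \<sigma>) (4 * \<sigma> * a) (\<lambda>x. kummer a (1/2) (\<sigma> * x\<^sup>2))
     (\<lambda>x. 4 * \<sigma> * a * x * kummer (a + 1) (3/2) (\<sigma> * x\<^sup>2))"
  unfolding hermite_ode_def
proof (intro allI conjI)
  fix x :: real
  let ?z = "\<sigma> * x\<^sup>2"
  note M' = kummer_square_has_derivative[of "1/2" a \<sigma> x, simplified]
  note M'' = kummer_square_has_derivative[of "3/2" "a + 1" \<sigma> x, simplified]
  show "((\<lambda>x. kummer a (1/2) (\<sigma> * x\<^sup>2)) has_real_derivative
      4 * \<sigma> * a * x * kummer (a + 1) (3/2) ?z) (at x)"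
    using M' by (simp add: algebra_simps)
  have K: "?z * (a * ((a + 1) * (4/3) * kummer (a + 2) (5/2) ?z)) +
      (1/2 - ?z) * (2 * a * kummer (a + 1) (3/2) ?z) = a * kummer a (1/2) ?z"
    using kummer_equation[of "1/2" ?z a] by (simp add: algebra_simps)
  have "((\<lambda>x. 4 * \<sigma> * a * x * kummer (a + 1) (3/2) (\<sigma> * x\<^sup>2)) has_real_derivative
      4 * \<sigma> * a * kummer (a + 1) (3/2) ?z +
      4 * \<sigma> * a * x * ((a + 1) * (2/3) * kummer (a + 2) (5/2) ?z * (\<sigma> * (2 * x)))) (at x)"
    by (rule DERIV_cong, (rule derivative_eq_intros M'' refl)+)
      (simp add: algebra_simps power2_eq_square, (simp add: algebra_simps)?)
  moreover have "4 * \<sigma> * a * kummer (a + 1) (3/2) ?z +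
      4 * \<sigma> * a * x * ((a + 1) * (2/3) * kummer (a + 2) (5/2) ?z * (\<sigma> * (2 * x))) =
      2 * \<sigma> * x * (4 * \<sigma> * a * x * kummer (a + 1) (3/2) ?z) + 4 * \<sigma> * a * kummer a (1/2) ?z"
    using arg_cong[OF K, of "\<lambda>u. 4 * \<sigma> * u"] by (simp add: algebra_simps power2_eq_square)
  ultimately show "((\<lambda>x. 4 * \<sigma> * a * x * kummer (a + 1) (3/2) (\<sigma> * x\<^sup>2)) has_real_derivative
      2 * \<sigma> * x * (4 * \<sigma> * a * x * kummer (a + 1) (3/2) ?z) + 4 * \<sigma> * a * kummer a (1/2) ?z) (at x)"
    by simp
qed

text \<open>The second solution \<open>z\<^bsup>1-b\<^esup> M(a - b + 1, 2 - b, z)\<close> of the Kummer equation with \<open>b = 1/2\<close>, up to a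
  constant factor; it complements the even one, since its initial values are \<open>0\<close> and \<open>1\<close>.\<close>
lemma odd_kummer_ode:
  "hermite_ode (2 * \<sigma>) (4 * \<sigma> * a) (\<lambda>x. x * kummer (a + 1/2) (3/2) (\<sigma> * x\<^sup>2))
     (\<lambda>x. kummer (a + 1/2) (3/2) (\<sigma> * x\<^sup>2) +
           4/3 * \<sigma> * (a + 1/2) * x\<^sup>2 * kummer (a + 3/2) (5/2) (\<sigma> * x\<^sup>2))"
  unfolding hermite_ode_def
proof (intro allI conjI)
  fix x :: real
  let ?z = "\<sigma> * x\<^sup>2"
  let ?N = "kummer (a + 1/2) (3/2) ?z"
  let ?N' = "2/3 * (a + 1/2) * kummer (a + 3/2) (5/2) ?z"
  let ?N'' = "2/3 * (a + 1/2) * (2/5 * (a + 3/2) * kummer (a + 5/2) (7/2) ?z)"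
  note N' = kummer_square_has_derivative[of "3/2" "a + 1/2" \<sigma> x, simplified]
  note N'' = kummer_square_has_derivative[of "5/2" "a + 3/2" \<sigma> x, simplified]
  show "((\<lambda>x. x * kummer (a + 1/2) (3/2) (\<sigma> * x\<^sup>2)) has_real_derivative
      ?N + 4/3 * \<sigma> * (a + 1/2) * x\<^sup>2 * kummer (a + 3/2) (5/2) ?z) (at x)"
    by (rule DERIV_cong, (rule derivative_eq_intros N' refl)+)
      (simp add: algebra_simps power2_eq_square, (simp add: algebra_simps)?)
  have K: "?z * ?N'' + (3/2 - ?z) * ?N' = (a + 1/2) * ?N"
    using kummer_equation[of "3/2" ?z "a + 1/2"] by (simp add: field_simps)
  have "((\<lambda>x. kummer (a + 1/2) (3/2) (\<sigma> * x\<^sup>2) +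
        4/3 * \<sigma> * (a + 1/2) * x\<^sup>2 * kummer (a + 3/2) (5/2) (\<sigma> * x\<^sup>2)) has_real_derivative
      6 * \<sigma> * x * ?N' + 4 * \<sigma> * x * (?z * ?N'')) (at x)"
    by (rule DERIV_cong, (rule derivative_eq_intros N' N'' refl)+)
      (simp add: field_simps power2_eq_square)
  moreover have "6 * \<sigma> * x * ?N' + 4 * \<sigma> * x * (?z * ?N'') =
      2 * \<sigma> * x * (?N + 4/3 * \<sigma> * (a + 1/2) * x\<^sup>2 * kummer (a + 3/2) (5/2) ?z) +
      4 * \<sigma> * a * (x * ?N)"
    using arg_cong[OF K, of "\<lambda>u. 4 * \<sigma> * x * u"] by (simp add: field_simps power2_eq_square)
  ultimately show "((\<lambda>x. kummer (a + 1/2) (3/2) (\<sigma> * x\<^sup>2) +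
        4/3 * \<sigma> * (a + 1/2) * x\<^sup>2 * kummer (a + 3/2) (5/2) (\<sigma> * x\<^sup>2)) has_real_derivative
      2 * \<sigma> * x * (?N + 4/3 * \<sigma> * (a + 1/2) * x\<^sup>2 * kummer (a + 3/2) (5/2) ?z) +
      4 * \<sigma> * a * (x * ?N)) (at x)"
    by simp
qed

text \<open>Abel's identity: the Wronskian \<open>w\<close> itself satisfies \<open>w' = p x w\<close>.\<close>
lemma abel_wronskian:
  assumes y: "hermite_ode p q y y'" and w: "hermite_ode p q w w'"
  shows "y x * w' x - y' x * w x = (y 0 * w' 0 - y' 0 * w 0) * exp (p * x\<^sup>2 / 2)"
proof -
  define V where "V = (\<lambda>x. (y x * w' x - y' x * w x) * exp (- (p * x\<^sup>2 / 2)))"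
  have "(V has_real_derivative 0) (at x)" for x
    unfolding V_def
    by (rule derivative_eq_intros hermite_odeD[OF y] hermite_odeD[OF w] refl
        | simp add: algebra_simps)+
  then have "V x = V 0"
    by (intro DERIV_isconst_all) simp
  then show ?thesis
    by (simp add: V_def exp_minus field_simps)
qed

text \<open>Uniqueness for the initial value problem. The Wronskian of \<open>y\<close> and the positive solution \<open>w\<close>
  vanishes identically, so \<open>y / w\<close> is constant.\<close>
lemma hermite_ode_zero:
  assumes y: "hermite_ode p q y y'" and w: "hermite_ode p q w w'"
    and pos: "\<And>x. w x > 0" and init: "y 0 = 0" "y' 0 = 0"
  shows "y x = 0"
proof -
  have W: "w x * y' x = w' x * y x" for x
    using abel_wronskian[OF w y, of x] init by simp
  have "((\<lambda>x. y x / w x) has_real_derivative 0) (at x)" for x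
    using pos[of x] W[of x]
    by (auto intro!: derivative_eq_intros hermite_odeD[OF y] hermite_odeD[OF w] simp: mult.commute)
  then have "y x / w x = y 0 / w 0"
    by (intro DERIV_isconst_all) simp
  then show ?thesis
    using init pos[of x] by simp
qed

text \<open>The Gaussian factor exchanges the two signs of \<open>p\<close>.\<close>
lemma hermite_ode_gauss:
  assumes "hermite_ode 2 (q + 2) z z'"
  shows "hermite_ode (- 2) q (\<lambda>x. exp (- x\<^sup>2) * z x) (\<lambda>x. exp (- x\<^sup>2) * (z' x - 2 * x * z x))"
  unfolding hermite_ode_def
  by (intro allI conjI;
      (rule derivative_eq_intros hermite_odeD[OF assms] refl
        | simp add: algebra_simps power2_eq_square)+)

text \<open>Kummer's transformation \<open>M(b - a, b, - z) = exp (- z) M(a, b, z)\<close> for \<open>b = 1/2, 3/2\<close>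
  and \<open>z = x\<^sup>2\<close>. Both sides solve the profile equation with the same initial values, and for
  \<open>\<alpha> \<ge> 0\<close> the right-hand side of the first identity is a positive solution, as the uniqueness
  argument requires.\<close>
lemma kummer_transformation:
  assumes "\<alpha> \<ge> 0"
  shows "kummer (- \<alpha> / 2) (1/2) (- x\<^sup>2) = exp (- x\<^sup>2) * kummer (\<alpha> / 2 + 1/2) (1/2) (x\<^sup>2)"
    and "x * kummer (- \<alpha> / 2 + 1/2) (3/2) (- x\<^sup>2) = exp (- x\<^sup>2) * (x * kummer (\<alpha> / 2 + 1) (3/2) (x\<^sup>2))"
proof -
  note minus = even_kummer_ode[of "-1" "- \<alpha> / 2", simplified]
    odd_kummer_ode[of "-1" "- \<alpha> / 2", simplified]
  have P: "hermite_ode 2 (2 * \<alpha> + 2) (\<lambda>x. kummer (\<alpha> / 2 + 1/2) (1/2) (x\<^sup>2))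
      (\<lambda>x. 4 * (\<alpha> / 2 + 1/2) * x * kummer (\<alpha> / 2 + 1/2 + 1) (3/2) (x\<^sup>2))"
    using even_kummer_ode[of 1 "\<alpha> / 2 + 1/2"] by (simp add: algebra_simps)
  obtain Q' where Q: "hermite_ode 2 (2 * \<alpha> + 2) (\<lambda>x. x * kummer (\<alpha> / 2 + 1) (3/2) (x\<^sup>2)) Q'"
    and Q'0: "Q' 0 = 1"
  proof
    show "hermite_ode 2 (2 * \<alpha> + 2) (\<lambda>x. x * kummer (\<alpha> / 2 + 1) (3/2) (x\<^sup>2))
        (\<lambda>x. kummer (\<alpha> / 2 + 1) (3/2) (x\<^sup>2) +
          4/3 * (\<alpha> / 2 + 1) * x\<^sup>2 * kummer (\<alpha> / 2 + 2) (5/2) (x\<^sup>2))"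
      using odd_kummer_ode[of 1 "\<alpha> / 2 + 1/2"] by (simp add: algebra_simps)
  qed simp
  note P' = hermite_ode_gauss[OF P] and Q' = hermite_ode_gauss[OF Q]
  have pos: "exp (- x\<^sup>2) * kummer (\<alpha> / 2 + 1/2) (1/2) (x\<^sup>2) > 0" for x
    using kummer_ge_1[of "\<alpha> / 2 + 1/2" "1/2" "x\<^sup>2"] assms by simp
  note zero = hermite_ode_zero[OF hermite_ode_combination[where m = 1 and n = "-1"] P' pos]
  show "kummer (- \<alpha> / 2) (1/2) (- x\<^sup>2) = exp (- x\<^sup>2) * kummer (\<alpha> / 2 + 1/2) (1/2) (x\<^sup>2)"
    using zero[OF minus(1) P', of x] by simp
  show "x * kummer (- \<alpha> / 2 + 1/2) (3/2) (- x\<^sup>2) = exp (- x\<^sup>2) * (x * kummer (\<alpha> / 2 + 1) (3/2) (x\<^sup>2))"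
    using zero[OF minus(2) Q', of x] Q'0 by simp
qed


section \<open>The growing solutions and the equations for the front\<close>

definition growth_even :: "real \<Rightarrow> real \<Rightarrow> real" where
  "growth_even \<alpha> x = kummer (\<alpha> / 2 + 1/2) (1/2) (x\<^sup>2)"

definition growth_odd :: "real \<Rightarrow> real \<Rightarrow> real" where
  "growth_odd \<alpha> x = x * kummer (\<alpha> / 2 + 1) (3/2) (x\<^sup>2)"

lemma growth_even_pos:
  assumes "\<alpha> \<ge> 0"
  shows "growth_even \<alpha> x > 0"
  using kummer_ge_1[of "\<alpha> / 2 + 1/2" "1/2" "x\<^sup>2"] assms by (simp add: growth_even_def)

lemma growth_odd_pos:
  assumes "\<alpha> \<ge> 0" "x > 0"
  shows "growth_odd \<alpha> x > 0"
  using kummer_ge_1[of "\<alpha> / 2 + 1" "3/2" "x\<^sup>2"] assms by (simp add: growth_odd_def)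

lemma growth_mono:
  assumes "\<alpha> \<ge> 0" "0 \<le> x" "x \<le> y"
  shows "growth_even \<alpha> x \<le> growth_even \<alpha> y"
    and "growth_odd \<alpha> x \<le> growth_odd \<alpha> y"
proof -
  have "x\<^sup>2 \<le> y\<^sup>2"
    using assms by simp
  then show "growth_even \<alpha> x \<le> growth_even \<alpha> y" "growth_odd \<alpha> x \<le> growth_odd \<alpha> y"
    using assms kummer_ge_1[of "\<alpha> / 2 + 1" "3/2" "x\<^sup>2"]
    by (auto simp: growth_even_def growth_odd_def intro!: kummer_mono mult_mono)
qed

lemma continuous_on_growth:
  shows "continuous_on S (growth_even \<alpha>)"
    and "continuous_on S (growth_odd \<alpha>)"
proof -
  have "continuous_on S (\<lambda>x. kummer a b (x\<^sup>2))" if "b > 0" for a b :: real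
    using kummer_square_has_derivative[OF that, of a 1]
    by (intro continuous_at_imp_continuous_on ballI DERIV_isCont) auto
  then show "continuous_on S (growth_even \<alpha>)" "continuous_on S (growth_odd \<alpha>)"
    by (auto simp: growth_even_def[abs_def] growth_odd_def[abs_def] intro!: continuous_intros)
qed

text \<open>The values at the front of the functions \<open>A\<close> and \<open>\<nu> B\<close> that enter the coefficients of both
  similarity solutions: up to one common positive factor they are \<open>P(\<nu>)\<close> and \<open>Q(\<nu>)\<close>.\<close>
lemma decaying_pair_eq_growth:
  assumes "\<alpha> \<ge> 0"
  shows "kummer (- \<alpha> / 2) (1/2) (- (\<nu>\<^sup>2)) = exp (- \<nu>\<^sup>2) * growth_even \<alpha> \<nu>"
    and "\<nu> * kummer (- \<alpha> / 2 + 1/2) (3/2) (- (\<nu>\<^sup>2)) = exp (- \<nu>\<^sup>2) * growth_odd \<alpha> \<nu>"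
  using kummer_transformation[OF assms, of \<nu>] by (simp_all add: growth_even_def growth_odd_def)

text \<open>The equation says that \<open>x\<^sup>\<beta> w(x) = K\<close>. Its left-hand side increases strictly from \<open>0\<close>, and it is
  unbounded because \<open>w(x) \<ge> w(1) > 0\<close> for \<open>x \<ge> 1\<close>.\<close>
lemma ex1_powr_eq_inverse:
  fixes w :: "real \<Rightarrow> real"
  assumes "\<beta> > 0" "K > 0" and cont: "continuous_on {0..} w"
    and mono: "\<And>x y. 0 \<le> x \<Longrightarrow> x \<le> y \<Longrightarrow> w x \<le> w y"
    and pos: "\<And>x. x > 0 \<Longrightarrow> w x > 0"
  shows "\<exists>!x. x > 0 \<and> K * inverse (w x) = x powr \<beta>"
proof -
  define g where "g x = x powr \<beta> * w x" for x
  have root_iff: "K * inverse (w x) = x powr \<beta> \<longleftrightarrow> g x = K" if "x > 0" for x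
    using pos[OF that] by (auto simp: g_def field_simps)
  have strict: "g x < g y" if "0 < x" "x < y" for x y
    unfolding g_def using that assms(1) pos[of x] mono[of x y]
    by (intro mult_less_le_imp_less powr_less_mono2) auto
  \<comment> \<open>A point where \<open>g\<close> is at least \<open>K\<close>: there \<open>w\<close> is bounded below by its value at \<open>1\<close>.\<close>
  define M where "M = max 1 ((K / w 1) powr (1 / \<beta>))"
  have M: "M \<ge> 1"
    by (simp add: M_def)
  have "K / w 1 = ((K / w 1) powr (1 / \<beta>)) powr \<beta>"
    using assms(1,2) pos[of 1] by (simp add: powr_powr)
  also have "\<dots> \<le> M powr \<beta>"
    using assms(1) by (intro powr_mono2) (auto simp: M_def)
  finally have "K \<le> M powr \<beta> * w 1"
    using pos[of 1] by (simp add: field_simps)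
  also have "\<dots> \<le> g M"
    unfolding g_def using mono[of 1 M] M by (intro mult_left_mono) auto
  finally have "K \<le> g M" .
  moreover have "g 0 = 0"
    using assms(1) by (simp add: g_def)
  moreover have "continuous_on {0..M} g"
    unfolding g_def using assms(1)
    by (intro continuous_intros continuous_on_powr' continuous_on_subset[OF cont]) auto
  ultimately obtain x where x: "0 \<le> x" "g x = K"
    using IVT'[of g 0 K M] assms(2) M by auto
  then have "x > 0"
    using \<open>g 0 = 0\<close> assms(2) by (cases "x = 0") auto
  show ?thesis
  proof (rule ex1I[of _ x])
    show "x > 0 \<and> K * inverse (w x) = x powr \<beta>"
      using x \<open>x > 0\<close> root_iff by simp
    fix y assume "y > 0 \<and> K * inverse (w y) = y powr \<beta>"
    then show "y = x"
      using root_iff[of y] x \<open>x > 0\<close> strict[of x y] strict[of y x] by (cases x y rule: linorder_cases) auto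
  qed
qed


section \<open>Self-similar fields with a moving front\<close>

definition self_similar :: "real \<Rightarrow> real \<Rightarrow> (real \<Rightarrow> real) \<Rightarrow> real \<Rightarrow> real \<Rightarrow> real" where
  "self_similar \<alpha> d y x t = t powr (\<alpha> / 2) * y (x / (2 * sqrt (d * t)))"

lemma self_similar_deriv_x:
  assumes "\<And>z. (y has_real_derivative y' z) (at z)"
  shows "((\<lambda>x. self_similar \<alpha> d y x t) has_real_derivative
      self_similar \<alpha> d y' x t / (2 * sqrt (d * t))) (at x within S)"
proof -
  have "((\<lambda>x. x / (2 * sqrt (d * t))) has_real_derivative 1 / (2 * sqrt (d * t))) (at x within S)"
    by (rule DERIV_cdivide DERIV_ident)+
  from DERIV_cmult[OF DERIV_chain2[OF assms this], of "t powr (\<alpha> / 2)"] show ?thesis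
    by (simp add: self_similar_def)
qed

lemma self_similar_deriv_t:
  fixes x :: real
  assumes "\<And>z. (y has_real_derivative y' z) (at z)" "d > 0" "t > 0"
  defines "\<eta> \<equiv> x / (2 * sqrt (d * t))"
  shows "((\<lambda>t. self_similar \<alpha> d y x t) has_real_derivative
      t powr (\<alpha> / 2) * (\<alpha> * y \<eta> - \<eta> * y' \<eta>) / (2 * t)) (at t)"
proof -
  have dt: "d * t > 0"
    using assms by simp
  have "((\<lambda>t. x / (2 * sqrt (d * t))) has_real_derivative
      - (x * (2 * (d * (inverse (sqrt (d * t)) / 2)))) / (2 * sqrt (d * t))\<^sup>2) (at t)"
    using dt by (auto intro!: derivative_eq_intros simp: power2_eq_square)
  moreover have "- (x * (2 * (d * (inverse (sqrt (d * t)) / 2)))) / (2 * sqrt (d * t))\<^sup>2 = - \<eta> / (2 * t)"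
    using dt assms(2,3) unfolding \<eta>_def by (simp add: field_simps power_mult_distrib)
  ultimately have "((\<lambda>t. x / (2 * sqrt (d * t))) has_real_derivative - \<eta> / (2 * t)) (at t)"
    by simp
  note chain = DERIV_chain2[OF assms(1) this]
  have "((\<lambda>t. t powr (\<alpha> / 2)) has_real_derivative \<alpha> / 2 * (t powr (\<alpha> / 2) / t)) (at t)"
    using has_real_derivative_powr[OF assms(3), of "\<alpha> / 2"] assms(3) by (simp add: powr_diff)
  note product = DERIV_mult[OF this chain]
  show ?thesis
    unfolding self_similar_def
    by (rule DERIV_cong[OF product]) (use assms(3) in \<open>simp add: field_simps \<eta>_def\<close>)
qed

text \<open>With \<open>\<eta> = x / (2 sqrt (d t))\<close> one has \<open>u\<^sub>t = t\<^bsup>\<alpha>/2\<^esup> (\<alpha> y - \<eta> y') / (2 t)\<close> and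
  \<open>d u\<^sub>x\<^sub>x = t\<^bsup>\<alpha>/2\<^esup> y'' / (4 t)\<close>, so the heat equation is the profile equation.\<close>
lemma self_similar_heat_equation:
  assumes ode: "hermite_ode (- 2) (2 * \<alpha>) y y'" and "d > 0"
  shows "heat_equation_on d (self_similar \<alpha> d y) s"
  unfolding heat_equation_on_def
proof (intro exI allI impI conjI)
  fix t x :: real
  assume t: "t > 0"
  let ?\<eta> = "\<lambda>x t. x / (2 * sqrt (d * t))"
  let ?y'' = "\<lambda>z. - 2 * z * y' z + 2 * \<alpha> * y z"
  show "((\<lambda>x. self_similar \<alpha> d y x t) has_real_derivative
      self_similar \<alpha> d y' x t / (2 * sqrt (d * t))) (at x)"
    by (rule self_similar_deriv_x hermite_odeD[OF ode])+
  show "((\<lambda>x. self_similar \<alpha> d y' x t / (2 * sqrt (d * t))) has_real_derivative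
      self_similar \<alpha> d ?y'' x t / (2 * sqrt (d * t)) / (2 * sqrt (d * t))) (at x)"
    by (rule DERIV_cdivide self_similar_deriv_x hermite_odeD[OF ode])+
  show "((\<lambda>t. self_similar \<alpha> d y x t) has_real_derivative
      t powr (\<alpha> / 2) * (\<alpha> * y (?\<eta> x t) - ?\<eta> x t * y' (?\<eta> x t)) / (2 * t)) (at t)"
    using hermite_odeD(1)[OF ode] assms(2) t by (rule self_similar_deriv_t)
  have "2 * sqrt (d * t) * (2 * sqrt (d * t)) = 4 * (d * t)"
    using assms(2) t by simp
  then show "t powr (\<alpha> / 2) * (\<alpha> * y (?\<eta> x t) - ?\<eta> x t * y' (?\<eta> x t)) / (2 * t) =
      d * (self_similar \<alpha> d ?y'' x t / (2 * sqrt (d * t)) / (2 * sqrt (d * t)))"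
    using assms(2) t by (simp only: divide_divide_eq_left self_similar_def) (simp add: field_simps)
qed

text \<open>The quantity \<open>L(\<nu>)\<close>: the latent heat term at a front \<open>2 \<nu> sqrt (d t)\<close>, with the powers of \<open>t\<close>
  removed and scaled so that the Stefan condition is \<open>k y'(\<nu>) = - L(\<nu>)\<close>.\<close>
definition latent_rate :: "real \<Rightarrow> real \<Rightarrow> real \<Rightarrow> real \<Rightarrow> real" where
  "latent_rate \<alpha> d \<gamma> \<nu> = \<gamma> * 2 powr (\<alpha> + 1) * d powr (\<alpha> / 2 + 1) * \<nu> powr (\<alpha> + 1)"

text \<open>Both sides of the Stefan condition are multiples of \<open>t\<^bsup>(\<alpha>-1)/2\<^esup>\<close>, so it reduces to one equation
  between constants.\<close>
lemma self_similar_stefan: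
  assumes ode: "hermite_ode (- 2) (2 * \<alpha>) y y'" and pos: "d > 0" "\<nu> > 0" "t > 0"
    and flux: "k * y' \<nu> = - latent_rate \<alpha> d \<gamma> \<nu>"
  shows "stefan_condition \<alpha> k \<gamma> (self_similar \<alpha> d y) (\<lambda>t. 2 * \<nu> * sqrt (d * t)) t"
  unfolding stefan_condition_def
proof (intro exI conjI)
  let ?s = "2 * \<nu> * sqrt (d * t)"
  have dt: "d * t > 0"
    using pos by simp
  show "((\<lambda>x. self_similar \<alpha> d y x t) has_real_derivative
      self_similar \<alpha> d y' ?s t / (2 * sqrt (d * t))) (at ?s within {0..?s})"
    by (rule self_similar_deriv_x hermite_odeD[OF ode])+
  show "((\<lambda>t. 2 * \<nu> * sqrt (d * t)) has_real_derivative \<nu> * d / sqrt (d * t)) (at t)"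
    using DERIV_cmult[OF DERIV_chain2[OF DERIV_real_sqrt[OF dt] DERIV_cmult_Id], of "2 * \<nu>"]
    by (simp add: inverse_eq_divide)
  have "sqrt (d * t) powr \<alpha> = (d * t) powr (1/2 * \<alpha>)"
    unfolding powr_powr[symmetric] using dt by (subst powr_half_sqrt) auto
  also have "\<dots> = d powr (\<alpha> / 2) * t powr (\<alpha> / 2)"
    using pos by (simp add: powr_mult)
  finally have front: "?s powr \<alpha> = 2 powr \<alpha> * \<nu> powr \<alpha> * (d powr (\<alpha> / 2) * t powr (\<alpha> / 2))"
    using pos by (simp add: powr_mult)
  have flux': "k * y' \<nu> = - 2 * \<gamma> * (2 powr \<alpha> * \<nu> powr \<alpha> * d powr (\<alpha> / 2)) * (\<nu> * d)"
    unfolding flux latent_rate_def powr_add using pos by simp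
  have "k * (self_similar \<alpha> d y' ?s t / (2 * sqrt (d * t))) =
      k * y' \<nu> * (t powr (\<alpha> / 2) / (2 * sqrt (d * t)))"
    using dt by (simp add: self_similar_def)
  also have "\<dots> = - \<gamma> * ?s powr \<alpha> * (\<nu> * d / sqrt (d * t))"
    unfolding flux' front by simp
  finally show "k * (self_similar \<alpha> d y' ?s t / (2 * sqrt (d * t))) =
      - \<gamma> * ?s powr \<alpha> * (\<nu> * d / sqrt (d * t))" .
qed

text \<open>The initial values \<open>y(0)\<close> and \<open>y'(0)\<close> of the profile whose values at the front are \<open>y(\<nu>) = 0\<close> and
  \<open>k y'(\<nu>) = - L(\<nu>)\<close>.\<close>
definition front_temperature :: "real \<Rightarrow> real \<Rightarrow> real \<Rightarrow> real \<Rightarrow> real \<Rightarrow> real" where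
  "front_temperature \<alpha> d k \<gamma> \<nu> = latent_rate \<alpha> d \<gamma> \<nu> * growth_odd \<alpha> \<nu> / k"

definition front_gradient :: "real \<Rightarrow> real \<Rightarrow> real \<Rightarrow> real \<Rightarrow> real \<Rightarrow> real" where
  "front_gradient \<alpha> d k \<gamma> \<nu> = - latent_rate \<alpha> d \<gamma> \<nu> * growth_even \<alpha> \<nu> / k"

definition front_field :: "real \<Rightarrow> real \<Rightarrow> real \<Rightarrow> real \<Rightarrow> real \<Rightarrow> real \<Rightarrow> real \<Rightarrow> real" where
  "front_field \<alpha> d k \<gamma> \<nu> =
     similarity_field \<alpha> d (front_temperature \<alpha> d k \<gamma> \<nu>) (front_gradient \<alpha> d k \<gamma> \<nu>)"

text \<open>The coefficients make \<open>y\<close> vanish at \<open>\<nu>\<close> by the Kummer transformation. For the slope there, take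
  the Wronskian of the even solution \<open>F\<close> with \<open>y\<close>: it is \<open>y'(0) exp (- \<nu>\<^sup>2)\<close> by Abel's identity, and it
  is \<open>F(\<nu>) y'(\<nu>)\<close> since \<open>y(\<nu>) = 0\<close>.\<close>
lemma front_profile:
  fixes \<alpha> d k \<gamma> \<nu>
  assumes "\<alpha> \<ge> 0" "k > 0"
  obtains y y' where
    "front_field \<alpha> d k \<gamma> \<nu> = self_similar \<alpha> d y" "hermite_ode (- 2) (2 * \<alpha>) y y'"
    "y 0 = front_temperature \<alpha> d k \<gamma> \<nu>" "y' 0 = front_gradient \<alpha> d k \<gamma> \<nu>"
    "y \<nu> = 0" "k * y' \<nu> = - latent_rate \<alpha> d \<gamma> \<nu>"
proof -
  let ?F = "\<lambda>x. kummer (- \<alpha> / 2) (1/2) (- x\<^sup>2)"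
  let ?G = "\<lambda>x. x * kummer (- \<alpha> / 2 + 1/2) (3/2) (- x\<^sup>2)"
  let ?T = "front_temperature \<alpha> d k \<gamma> \<nu>" and ?g = "front_gradient \<alpha> d k \<gamma> \<nu>"
  define F' where "F' = (\<lambda>x. 2 * \<alpha> * x * kummer (- \<alpha> / 2 + 1) (3/2) (- x\<^sup>2))"
  define G' where "G' = (\<lambda>x. kummer (- \<alpha> / 2 + 1/2) (3/2) (- x\<^sup>2) -
      4/3 * (1/2 - \<alpha> / 2) * x\<^sup>2 * kummer (- \<alpha> / 2 + 3/2) (5/2) (- x\<^sup>2))"
  have F: "hermite_ode (- 2) (2 * \<alpha>) ?F F'" "F' 0 = 0"
    using even_kummer_ode[of "-1" "- \<alpha> / 2"] by (simp_all add: F'_def)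
  have G: "hermite_ode (- 2) (2 * \<alpha>) ?G G'" "G' 0 = 1"
    using odd_kummer_ode[of "-1" "- \<alpha> / 2"] by (simp_all add: G'_def)
  define y where "y = (\<lambda>x. ?T * ?F x + ?g * ?G x)"
  define y' where "y' = (\<lambda>x. ?T * F' x + ?g * G' x)"
  have ode: "hermite_ode (- 2) (2 * \<alpha>) y y'"
    unfolding y_def y'_def by (rule hermite_ode_combination[OF F(1) G(1)])
  have init: "y 0 = ?T" "y' 0 = ?g"
    using F(2) G(2) by (simp_all add: y_def y'_def)
  have zero: "y \<nu> = 0"
    unfolding y_def decaying_pair_eq_growth[OF assms(1)]
    by (simp add: front_temperature_def front_gradient_def)
  have "?F \<nu> * y' \<nu> = ?g * exp (- \<nu>\<^sup>2)"
    using abel_wronskian[OF F(1) ode, of \<nu>] init F(2) zero by simp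
  then have "growth_even \<alpha> \<nu> * y' \<nu> = ?g"
    unfolding decaying_pair_eq_growth[OF assms(1)] by (simp add: mult.commute)
  then have "growth_even \<alpha> \<nu> * (k * y' \<nu>) = growth_even \<alpha> \<nu> * (- latent_rate \<alpha> d \<gamma> \<nu>)"
    using assms(2) by (simp add: front_gradient_def field_simps)
  then have "k * y' \<nu> = - latent_rate \<alpha> d \<gamma> \<nu>"
    using growth_even_pos[OF assms(1), of \<nu>] by (simp only: mult_cancel_left) simp
  moreover have "front_field \<alpha> d k \<gamma> \<nu> = self_similar \<alpha> d y"
    by (simp add: fun_eq_iff front_field_def similarity_field_def self_similar_def y_def Let_def mult.assoc)
  ultimately show thesis
    using that ode init zero by blast
qed

lemma front_field_solves_P2:
  assumes "\<alpha> \<ge> 0" "d > 0" "k > 0" "\<gamma> > 0" "\<nu> > 0"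
  shows "solves_P2 \<alpha> d k \<gamma> (front_temperature \<alpha> d k \<gamma> \<nu>) (front_field \<alpha> d k \<gamma> \<nu>)
    (\<lambda>t. 2 * \<nu> * sqrt (d * t))"
proof -
  obtain y y' where y: "front_field \<alpha> d k \<gamma> \<nu> = self_similar \<alpha> d y" "hermite_ode (- 2) (2 * \<alpha>) y y'"
    "y 0 = front_temperature \<alpha> d k \<gamma> \<nu>" "y \<nu> = 0" "k * y' \<nu> = - latent_rate \<alpha> d \<gamma> \<nu>"
    by (rule front_profile[OF assms(1,3), of d \<gamma> \<nu>])
  have "front_temperature \<alpha> d k \<gamma> \<nu> > 0"
    using assms growth_odd_pos[OF assms(1,5)] by (simp add: front_temperature_def latent_rate_def)
  then show ?thesis
    unfolding solves_P2_def y(1)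
  proof (intro conjI allI impI)
    fix t :: real
    assume t: "t > 0"
    show "stefan_condition \<alpha> k \<gamma> (self_similar \<alpha> d y) (\<lambda>t. 2 * \<nu> * sqrt (d * t)) t"
      by (rule self_similar_stefan[OF y(2) assms(2,5) t y(5)])
  qed (use assms(2,5) y(3,4) in \<open>auto simp: self_similar_def intro: self_similar_heat_equation[OF y(2)]\<close>)
qed

text \<open>The hypothesis \<open>balance\<close> is the convective condition with the common power of \<open>t\<close> removed; all the
  other conditions of (P1) are shared with (P2).\<close>
lemma front_field_solves_P1:
  assumes "\<alpha> \<ge> 0" "d > 0" "k > 0" "\<gamma> > 0" "\<nu> > 0" "h\<^sub>0 > 0" "T_inf > 0"
    and balance: "2 * sqrt d * h\<^sub>0 * (T_inf - front_temperature \<alpha> d k \<gamma> \<nu>) =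
      - k * front_gradient \<alpha> d k \<gamma> \<nu>"
  shows "solves_P1 \<alpha> d k \<gamma> h\<^sub>0 T_inf (front_field \<alpha> d k \<gamma> \<nu>) (\<lambda>t. 2 * \<nu> * sqrt (d * t))"
proof -
  obtain y y' where y: "front_field \<alpha> d k \<gamma> \<nu> = self_similar \<alpha> d y" "hermite_ode (- 2) (2 * \<alpha>) y y'"
    "y 0 = front_temperature \<alpha> d k \<gamma> \<nu>" "y' 0 = front_gradient \<alpha> d k \<gamma> \<nu>"
    by (rule front_profile[OF assms(1,3), of d \<gamma> \<nu>])
  have "k * (self_similar \<alpha> d y' 0 t / (2 * sqrt (d * t))) =
      h\<^sub>0 * t powr (- 1/2) * (self_similar \<alpha> d y 0 t - T_inf * t powr (\<alpha> / 2))" if "t > 0" for t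
  proof -
    have root: "t powr (- 1/2) = 1 / sqrt t"
      using that powr_minus_divide[of t "1/2"] by (simp add: powr_half_sqrt)
    have "k * (self_similar \<alpha> d y' 0 t / (2 * sqrt (d * t))) =
        k * front_gradient \<alpha> d k \<gamma> \<nu> * (t powr (\<alpha> / 2) / (2 * sqrt d * sqrt t))"
      by (simp add: self_similar_def y real_sqrt_mult mult_ac)
    also have "k * front_gradient \<alpha> d k \<gamma> \<nu> = 2 * sqrt d * h\<^sub>0 * (front_temperature \<alpha> d k \<gamma> \<nu> - T_inf)"
      using balance by (simp add: algebra_simps)
    also have "2 * sqrt d * h\<^sub>0 * (front_temperature \<alpha> d k \<gamma> \<nu> - T_inf) *
        (t powr (\<alpha> / 2) / (2 * sqrt d * sqrt t)) =
        h\<^sub>0 * t powr (- 1/2) * (self_similar \<alpha> d y 0 t - T_inf * t powr (\<alpha> / 2))"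
      unfolding root using assms(2) that by (simp add: self_similar_def y field_simps)
    finally show ?thesis .
  qed
  then show ?thesis
    using front_field_solves_P2[OF assms(1-5)] assms(6,7)
      self_similar_deriv_x[OF hermite_odeD(1)[OF y(2)], where x = 0]
    unfolding solves_P1_def solves_P2_def y(1) by meson
qed


section \<open>The front equations as conditions at the fixed boundary\<close>

text \<open>Since \<open>L(\<nu>) = 2 sqrt d S \<nu>\<^bsup>\<alpha>+1\<^esup>\<close> with \<open>S = \<gamma> 2\<^sup>\<alpha> d\<^bsup>(\<alpha>+1)/2\<^esup>\<close>, clearing denominators turns the
  equation into \<open>2 sqrt d h\<^sub>0 T\<^sub>\<infinity> = L(\<nu>) (P(\<nu>) + 2 sqrt d h\<^sub>0 Q(\<nu>) / k)\<close>, which is the convective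
  condition for the profile with front \<open>\<nu>\<close>.\<close>
lemma nu_equation_iff:
  assumes "\<alpha> \<ge> 0" "d > 0" "k > 0" "\<gamma> > 0" "\<nu> > 0" "h\<^sub>0 > 0"
  shows "h\<^sub>0 * T_inf / (\<gamma> * 2 powr \<alpha> * d powr ((\<alpha> + 1) / 2)) * f\<^sub>1 \<alpha> d k h\<^sub>0 \<nu> = \<nu> powr (\<alpha> + 1) \<longleftrightarrow>
    2 * sqrt d * h\<^sub>0 * (T_inf - front_temperature \<alpha> d k \<gamma> \<nu>) = - k * front_gradient \<alpha> d k \<gamma> \<nu>"
proof -
  define P Q S W L where "P = growth_even \<alpha> \<nu>" and "Q = growth_odd \<alpha> \<nu>"
    and "S = \<gamma> * 2 powr \<alpha> * d powr ((\<alpha> + 1) / 2)"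
    and "W = P + 2 * (sqrt d * h\<^sub>0 / k) * Q" and "L = latent_rate \<alpha> d \<gamma> \<nu>"
  have pos: "P > 0" "Q > 0" "S > 0"
    using assms growth_even_pos growth_odd_pos by (auto simp: P_def Q_def S_def)
  then have "W > 0"
    unfolding W_def using assms by (intro add_pos_nonneg) auto
  have f\<^sub>1: "f\<^sub>1 \<alpha> d k h\<^sub>0 \<nu> = inverse W"
    by (simp add: f\<^sub>1_def W_def P_def Q_def growth_even_def growth_odd_def mult.assoc)
  have "d powr (\<alpha> / 2 + 1) = d powr ((\<alpha> + 1) / 2) * sqrt d"
    using assms(2) by (simp add: powr_half_sqrt[symmetric] powr_add[symmetric] add_divide_distrib
      add.commute)
  then have L: "L = 2 * sqrt d * (S * \<nu> powr (\<alpha> + 1))"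
    by (simp add: L_def latent_rate_def S_def powr_add)
  have "h\<^sub>0 * T_inf / S * f\<^sub>1 \<alpha> d k h\<^sub>0 \<nu> = \<nu> powr (\<alpha> + 1) \<longleftrightarrow>
      h\<^sub>0 * T_inf = S * \<nu> powr (\<alpha> + 1) * W"
    unfolding f\<^sub>1 using pos \<open>W > 0\<close> by (auto simp: field_simps)
  also have "\<dots> \<longleftrightarrow> 2 * sqrt d * (h\<^sub>0 * T_inf) = 2 * sqrt d * (S * \<nu> powr (\<alpha> + 1) * W)"
    using assms(2) by simp
  also have "2 * sqrt d * (S * \<nu> powr (\<alpha> + 1) * W) = L * P + 2 * sqrt d * h\<^sub>0 * (L * Q / k)"
    by (simp add: L W_def algebra_simps)
  also have "2 * sqrt d * (h\<^sub>0 * T_inf) = L * P + 2 * sqrt d * h\<^sub>0 * (L * Q / k) \<longleftrightarrow>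
      2 * sqrt d * h\<^sub>0 * (T_inf - L * Q / k) = L * P"
    by (simp only: right_diff_distrib mult.assoc diff_eq_eq)
  also have "L * P = - k * front_gradient \<alpha> d k \<gamma> \<nu>"
    using assms(3) by (simp add: front_gradient_def L_def P_def)
  also have "L * Q / k = front_temperature \<alpha> d k \<gamma> \<nu>"
    by (simp add: front_temperature_def L_def Q_def)
  finally show ?thesis
    unfolding S_def .
qed

text \<open>Clearing denominators gives \<open>k T\<^sub>0 = L(\<mu>) Q(\<mu>)\<close>, the temperature condition at \<open>x = 0\<close>.\<close>
lemma mu_equation_iff:
  assumes "\<alpha> \<ge> 0" "d > 0" "k > 0" "\<gamma> > 0" "\<mu> > 0"
  shows "k * T\<^sub>0 / (2 powr (\<alpha> + 1) * d powr (\<alpha> / 2 + 1) * \<gamma>) * f\<^sub>2 \<alpha> \<mu> = \<mu> powr (\<alpha> + 1) \<longleftrightarrow>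
    T\<^sub>0 = front_temperature \<alpha> d k \<gamma> \<mu>"
proof -
  have f\<^sub>2: "f\<^sub>2 \<alpha> \<mu> = inverse (growth_odd \<alpha> \<mu>)"
    by (simp add: f\<^sub>2_def growth_odd_def)
  show ?thesis
    unfolding f\<^sub>2 using assms growth_odd_pos[OF assms(1,5)]
    by (simp add: front_temperature_def latent_rate_def field_simps)
qed

lemma nu_P1_unique:
  assumes "\<alpha> \<ge> 0" "d > 0" "k > 0" "\<gamma> > 0" "h\<^sub>0 > 0" "T_inf > 0"
  shows "\<exists>!x. x > 0 \<and>
    h\<^sub>0 * T_inf / (\<gamma> * 2 powr \<alpha> * d powr ((\<alpha> + 1) / 2)) * f\<^sub>1 \<alpha> d k h\<^sub>0 x = x powr (\<alpha> + 1)"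
proof -
  let ?w = "\<lambda>x. growth_even \<alpha> x + 2 * (sqrt d * h\<^sub>0 / k) * growth_odd \<alpha> x"
  have "f\<^sub>1 \<alpha> d k h\<^sub>0 = (\<lambda>x. inverse (?w x))"
    by (simp add: fun_eq_iff f\<^sub>1_def growth_even_def growth_odd_def mult.assoc)
  moreover have "\<exists>!x. x > 0 \<and>
      h\<^sub>0 * T_inf / (\<gamma> * 2 powr \<alpha> * d powr ((\<alpha> + 1) / 2)) * inverse (?w x) = x powr (\<alpha> + 1)"
  proof (rule ex1_powr_eq_inverse)
    show "continuous_on {0..} ?w"
      by (intro continuous_intros continuous_on_growth)
    show "?w x \<le> ?w y" if "0 \<le> x" "x \<le> y" for x y
      using that assms by (intro add_mono growth_mono mult_left_mono) auto
    show "?w x > 0" if "x > 0" for x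
      using that assms growth_even_pos growth_odd_pos by (simp add: add_pos_pos)
  qed (use assms in auto)
  ultimately show ?thesis
    by simp
qed

lemma mu_P2_unique:
  assumes "\<alpha> \<ge> 0" "d > 0" "k > 0" "\<gamma> > 0" "T\<^sub>0 > 0"
  shows "\<exists>!x. x > 0 \<and>
    k * T\<^sub>0 / (2 powr (\<alpha> + 1) * d powr (\<alpha> / 2 + 1) * \<gamma>) * f\<^sub>2 \<alpha> x = x powr (\<alpha> + 1)"
proof -
  have "f\<^sub>2 \<alpha> = (\<lambda>x. inverse (growth_odd \<alpha> x))"
    by (simp add: fun_eq_iff f\<^sub>2_def growth_odd_def)
  moreover have "\<exists>!x. x > 0 \<and>
      k * T\<^sub>0 / (2 powr (\<alpha> + 1) * d powr (\<alpha> / 2 + 1) * \<gamma>) * inverse (growth_odd \<alpha> x) = x powr (\<alpha> + 1)"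
    by (rule ex1_powr_eq_inverse)
      (use assms in \<open>auto intro: continuous_on_growth growth_mono growth_odd_pos\<close>)
  ultimately show ?thesis
    by simp
qed

lemma nu_P1_iff:
  assumes "\<alpha> \<ge> 0" "d > 0" "k > 0" "\<gamma> > 0" "h\<^sub>0 > 0" "T_inf > 0"
  shows "nu_P1 \<alpha> d k \<gamma> h\<^sub>0 T_inf = \<nu> \<longleftrightarrow> \<nu> > 0 \<and>
    2 * sqrt d * h\<^sub>0 * (T_inf - front_temperature \<alpha> d k \<gamma> \<nu>) = - k * front_gradient \<alpha> d k \<gamma> \<nu>"
proof -
  note unique = nu_P1_unique[OF assms] and equation = nu_equation_iff[OF assms(1-4) _ assms(5)]
  show ?thesis
  proof
    assume "nu_P1 \<alpha> d k \<gamma> h\<^sub>0 T_inf = \<nu>"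
    then show "\<nu> > 0 \<and>
        2 * sqrt d * h\<^sub>0 * (T_inf - front_temperature \<alpha> d k \<gamma> \<nu>) = - k * front_gradient \<alpha> d k \<gamma> \<nu>"
      using theI'[OF unique] equation[of \<nu> T_inf] unfolding nu_P1_def[symmetric] by simp
  next
    assume \<nu>: "\<nu> > 0 \<and>
        2 * sqrt d * h\<^sub>0 * (T_inf - front_temperature \<alpha> d k \<gamma> \<nu>) = - k * front_gradient \<alpha> d k \<gamma> \<nu>"
    show "nu_P1 \<alpha> d k \<gamma> h\<^sub>0 T_inf = \<nu>"
      unfolding nu_P1_def
    proof (rule the1_equality[OF unique])
      show "\<nu> > 0 \<and> h\<^sub>0 * T_inf / (\<gamma> * 2 powr \<alpha> * d powr ((\<alpha> + 1) / 2)) * f\<^sub>1 \<alpha> d k h\<^sub>0 \<nu> = \<nu> powr (\<alpha> + 1)"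
        using equation[of \<nu> T_inf] \<nu> by (intro conjI) (rule conjunct1[OF \<nu>], blast)
    qed
  qed
qed

lemma mu_P2_iff:
  assumes "\<alpha> \<ge> 0" "d > 0" "k > 0" "\<gamma> > 0" "T\<^sub>0 > 0"
  shows "mu_P2 \<alpha> d k \<gamma> T\<^sub>0 = \<mu> \<longleftrightarrow> \<mu> > 0 \<and> T\<^sub>0 = front_temperature \<alpha> d k \<gamma> \<mu>"
  using theI'[OF mu_P2_unique[OF assms]] the1_equality[OF mu_P2_unique[OF assms]]
    mu_equation_iff[OF assms(1-4)]
  unfolding mu_P2_def by blast


section \<open>Equivalence of the two problems\<close>

text \<open>By the convective condition the denominator is, up to the factor \<open>exp (- \<nu>\<^sup>2)\<close>, equal to
  \<open>2 sqrt d h\<^sub>0 T\<^sub>\<infinity> k / L(\<nu>)\<close>, so the two fractions collapse to \<open>y(0)\<close> and \<open>y'(0)\<close>. The first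
  is the datum \<open>T\<^sub>0\<close> of part (a), the second the coefficient \<open>c\<^sub>2\<^sub>1\<close>.\<close>
lemma convective_coefficients:
  fixes \<alpha> d k \<gamma> \<nu> h\<^sub>0 T_inf :: real
  assumes "\<alpha> \<ge> 0" "d > 0" "k > 0" "\<nu> > 0" "h\<^sub>0 > 0"
    and balance: "2 * sqrt d * h\<^sub>0 * (T_inf - front_temperature \<alpha> d k \<gamma> \<nu>) =
      - k * front_gradient \<alpha> d k \<gamma> \<nu>"
  defines "A \<equiv> kummer (- \<alpha> / 2) (1/2) (- (\<nu>\<^sup>2))" and "B \<equiv> kummer (- \<alpha> / 2 + 1/2) (3/2) (- (\<nu>\<^sup>2))"
  shows "2 * sqrt d * h\<^sub>0 * T_inf * \<nu> * B / (k * A + 2 * sqrt d * h\<^sub>0 * \<nu> * B) =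
      front_temperature \<alpha> d k \<gamma> \<nu>" (is ?temperature)
    and "- 2 * h\<^sub>0 * sqrt d * T_inf * A / (k * A + 2 * sqrt d * h\<^sub>0 * \<nu> * B) =
      front_gradient \<alpha> d k \<gamma> \<nu>" (is ?gradient)
proof -
  define P Q E L where "P = growth_even \<alpha> \<nu>" and "Q = growth_odd \<alpha> \<nu>" and "E = exp (- \<nu>\<^sup>2)"
    and "L = latent_rate \<alpha> d \<gamma> \<nu>"
  have pos: "P > 0" "Q > 0" "E > 0"
    using assms growth_even_pos growth_odd_pos by (auto simp: P_def Q_def E_def)
  have A: "A = E * P" and B: "\<nu> * B = E * Q"
    unfolding A_def B_def P_def Q_def E_def by (rule decaying_pair_eq_growth[OF assms(1)])+
  define D where "D = k * P + 2 * sqrt d * h\<^sub>0 * Q"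
  have "D > 0"
    unfolding D_def using pos assms by (intro add_pos_pos) auto
  have den: "k * A + 2 * sqrt d * h\<^sub>0 * \<nu> * B = E * D"
    using A B by (simp add: D_def algebra_simps)
  have drive: "2 * sqrt d * h\<^sub>0 * T_inf = L * D / k"
    using balance assms(3) unfolding front_temperature_def front_gradient_def D_def
      P_def[symmetric] Q_def[symmetric] L_def[symmetric]
    by (simp add: field_simps)
  have "2 * sqrt d * h\<^sub>0 * T_inf * \<nu> * B = L * D / k * (E * Q)"
    using B drive by (simp add: mult.assoc)
  then show ?temperature
    unfolding den front_temperature_def L_def[symmetric] Q_def[symmetric]
    using \<open>D > 0\<close> pos by simp
  have "- 2 * h\<^sub>0 * sqrt d * T_inf * A = - (L * D / k * (E * P))"
    using A drive by (simp add: algebra_simps)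
  then show ?gradient
    unfolding den front_gradient_def L_def[symmetric] P_def[symmetric]
    using \<open>D > 0\<close> pos by simp
qed

text \<open>The last equation says that the profile vanishes at the front; it gives the other
  coefficient of each similarity solution.\<close>
lemma front_ratio:
  fixes \<alpha> d k \<gamma> \<nu> :: real
  assumes "\<alpha> \<ge> 0" "\<nu> > 0"
  defines "A \<equiv> kummer (- \<alpha> / 2) (1/2) (- (\<nu>\<^sup>2))" and "B \<equiv> kummer (- \<alpha> / 2 + 1/2) (3/2) (- (\<nu>\<^sup>2))"
  shows "A > 0" "\<nu> * B > 0"
    and "front_temperature \<alpha> d k \<gamma> \<nu> * A = - front_gradient \<alpha> d k \<gamma> \<nu> * (\<nu> * B)"
  using assms growth_even_pos growth_odd_pos unfolding A_def B_def decaying_pair_eq_growth[OF assms(1)]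
  by (auto simp: front_temperature_def front_gradient_def)

lemma Psi_P1_eq_front_field:
  assumes "\<alpha> \<ge> 0" "d > 0" "k > 0" "\<gamma> > 0" "h\<^sub>0 > 0" "T_inf > 0"
    and "nu_P1 \<alpha> d k \<gamma> h\<^sub>0 T_inf = \<nu>"
  shows "Psi_P1 \<alpha> d k \<gamma> h\<^sub>0 T_inf = front_field \<alpha> d k \<gamma> \<nu>"
proof -
  have \<nu>: "\<nu> > 0" "2 * sqrt d * h\<^sub>0 * (T_inf - front_temperature \<alpha> d k \<gamma> \<nu>) =
      - k * front_gradient \<alpha> d k \<gamma> \<nu>"
    using nu_P1_iff[OF assms(1-6)] assms(7) by blast+
  note surface = convective_coefficients(2)[OF assms(1-3) \<nu>(1) assms(5) \<nu>(2)]
  note ratio = front_ratio(1,2)[OF assms(1) \<nu>(1)]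
    front_ratio(3)[where d = d and k = k and \<gamma> = \<gamma>, OF assms(1) \<nu>(1)]
  show ?thesis
    unfolding Psi_P1_def Let_def assms(7) front_field_def surface
    using ratio by (intro arg_cong2[where f = "similarity_field \<alpha> d"]) (simp_all add: field_simps)
qed

lemma Theta_P2_eq_front_field:
  assumes "\<alpha> \<ge> 0" "d > 0" "k > 0" "\<gamma> > 0" "T\<^sub>0 > 0"
    and "mu_P2 \<alpha> d k \<gamma> T\<^sub>0 = \<mu>"
  shows "Theta_P2 \<alpha> d k \<gamma> T\<^sub>0 = front_field \<alpha> d k \<gamma> \<mu>"
proof -
  have \<mu>: "\<mu> > 0" "T\<^sub>0 = front_temperature \<alpha> d k \<gamma> \<mu>"
    using mu_P2_iff[OF assms(1-5)] assms(6) by blast+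
  note ratio = front_ratio(1,2)[OF assms(1) \<mu>(1)]
    front_ratio(3)[where d = d and k = k and \<gamma> = \<gamma>, OF assms(1) \<mu>(1)]
  show ?thesis
    unfolding Theta_P2_def Let_def assms(6) front_field_def \<mu>(2)[symmetric]
    using ratio[folded \<mu>(2)]
    by (intro arg_cong2[where f = "similarity_field \<alpha> d"]) (auto simp: field_simps)
qed

text \<open>The front parameter determines the solution, whichever condition at \<open>x = 0\<close> selected it.\<close>
lemma problems_share_front:
  assumes "\<alpha> \<ge> 0" "d > 0" "k > 0" "\<gamma> > 0" "h\<^sub>0 > 0" "T_inf > 0" "T\<^sub>0 > 0"
    and same: "nu_P1 \<alpha> d k \<gamma> h\<^sub>0 T_inf = \<nu>" "mu_P2 \<alpha> d k \<gamma> T\<^sub>0 = \<nu>"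
  shows "solves_P1 \<alpha> d k \<gamma> h\<^sub>0 T_inf (Psi_P1 \<alpha> d k \<gamma> h\<^sub>0 T_inf) (s_P1 \<alpha> d k \<gamma> h\<^sub>0 T_inf)"
    and "solves_P2 \<alpha> d k \<gamma> T\<^sub>0 (Theta_P2 \<alpha> d k \<gamma> T\<^sub>0) (r_P2 \<alpha> d k \<gamma> T\<^sub>0)"
    and "Theta_P2 \<alpha> d k \<gamma> T\<^sub>0 = Psi_P1 \<alpha> d k \<gamma> h\<^sub>0 T_inf"
    and "r_P2 \<alpha> d k \<gamma> T\<^sub>0 = s_P1 \<alpha> d k \<gamma> h\<^sub>0 T_inf"
proof -
  have \<nu>: "\<nu> > 0" "T\<^sub>0 = front_temperature \<alpha> d k \<gamma> \<nu>"
      "2 * sqrt d * h\<^sub>0 * (T_inf - front_temperature \<alpha> d k \<gamma> \<nu>) = - k * front_gradient \<alpha> d k \<gamma> \<nu>"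
    using nu_P1_iff[OF assms(1-6)] mu_P2_iff[OF assms(1-4,7)] same by blast+
  have fronts: "s_P1 \<alpha> d k \<gamma> h\<^sub>0 T_inf = (\<lambda>t. 2 * \<nu> * sqrt (d * t))"
      "r_P2 \<alpha> d k \<gamma> T\<^sub>0 = (\<lambda>t. 2 * \<nu> * sqrt (d * t))"
    by (simp_all add: fun_eq_iff s_P1_def r_P2_def same)
  note fields = Psi_P1_eq_front_field[OF assms(1-6) same(1)]
    Theta_P2_eq_front_field[OF assms(1-4,7) same(2)]
  show "solves_P1 \<alpha> d k \<gamma> h\<^sub>0 T_inf (Psi_P1 \<alpha> d k \<gamma> h\<^sub>0 T_inf) (s_P1 \<alpha> d k \<gamma> h\<^sub>0 T_inf)"
    unfolding fields fronts using front_field_solves_P1[OF assms(1-4) \<nu>(1) assms(5,6) \<nu>(3)] .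
  show "solves_P2 \<alpha> d k \<gamma> T\<^sub>0 (Theta_P2 \<alpha> d k \<gamma> T\<^sub>0) (r_P2 \<alpha> d k \<gamma> T\<^sub>0)"
    unfolding fields fronts using front_field_solves_P2[OF assms(1-4) \<nu>(1)] \<nu>(2) by simp
  show "Theta_P2 \<alpha> d k \<gamma> T\<^sub>0 = Psi_P1 \<alpha> d k \<gamma> h\<^sub>0 T_inf" "r_P2 \<alpha> d k \<gamma> T\<^sub>0 = s_P1 \<alpha> d k \<gamma> h\<^sub>0 T_inf"
    by (simp_all add: fields fronts)
qed

theorem theorem3p1:
  fixes \<alpha> d k \<gamma> :: real
  assumes "\<alpha> \<ge> 0" "d > 0" "k > 0" "\<gamma> > 0"
  shows
    "(\<forall>h\<^sub>0 T_inf \<nu> T\<^sub>0.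
        h\<^sub>0 > 0 \<longrightarrow> T_inf > 0 \<longrightarrow> \<nu> = nu_P1 \<alpha> d k \<gamma> h\<^sub>0 T_inf \<longrightarrow>
        T\<^sub>0 = 2 * sqrt d * h\<^sub>0 * T_inf * \<nu> * kummer (- \<alpha> / 2 + 1/2) (3/2) (- (\<nu>\<^sup>2)) /
               (k * kummer (- \<alpha> / 2) (1/2) (- (\<nu>\<^sup>2)) +
                2 * sqrt d * h\<^sub>0 * \<nu> * kummer (- \<alpha> / 2 + 1/2) (3/2) (- (\<nu>\<^sup>2))) \<longrightarrow>
        solves_P1 \<alpha> d k \<gamma> h\<^sub>0 T_inf (Psi_P1 \<alpha> d k \<gamma> h\<^sub>0 T_inf) (s_P1 \<alpha> d k \<gamma> h\<^sub>0 T_inf) \<and>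
        solves_P2 \<alpha> d k \<gamma> T\<^sub>0 (Theta_P2 \<alpha> d k \<gamma> T\<^sub>0) (r_P2 \<alpha> d k \<gamma> T\<^sub>0) \<and>
        solutions_coincide (Psi_P1 \<alpha> d k \<gamma> h\<^sub>0 T_inf) (s_P1 \<alpha> d k \<gamma> h\<^sub>0 T_inf)
                           (Theta_P2 \<alpha> d k \<gamma> T\<^sub>0) (r_P2 \<alpha> d k \<gamma> T\<^sub>0)) \<and>
     (\<forall>T\<^sub>0 \<mu> T_inf h\<^sub>0.
        T\<^sub>0 > 0 \<longrightarrow> \<mu> = mu_P2 \<alpha> d k \<gamma> T\<^sub>0 \<longrightarrow> T_inf > T\<^sub>0 \<longrightarrow>
        h\<^sub>0 = - k * T\<^sub>0 * kummer (- \<alpha> / 2) (1/2) (- (\<mu>\<^sup>2)) /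
               (2 * sqrt d * (T\<^sub>0 - T_inf) * \<mu> * kummer (- \<alpha> / 2 + 1/2) (3/2) (- (\<mu>\<^sup>2))) \<longrightarrow>
        solves_P2 \<alpha> d k \<gamma> T\<^sub>0 (Theta_P2 \<alpha> d k \<gamma> T\<^sub>0) (r_P2 \<alpha> d k \<gamma> T\<^sub>0) \<and>
        solves_P1 \<alpha> d k \<gamma> h\<^sub>0 T_inf (Psi_P1 \<alpha> d k \<gamma> h\<^sub>0 T_inf) (s_P1 \<alpha> d k \<gamma> h\<^sub>0 T_inf) \<and>
        solutions_coincide (Theta_P2 \<alpha> d k \<gamma> T\<^sub>0) (r_P2 \<alpha> d k \<gamma> T\<^sub>0)
                           (Psi_P1 \<alpha> d k \<gamma> h\<^sub>0 T_inf) (s_P1 \<alpha> d k \<gamma> h\<^sub>0 T_inf))"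
proof (intro conjI allI impI)
  fix h\<^sub>0 T_inf \<nu> T\<^sub>0 :: real
  assume data: "h\<^sub>0 > 0" "T_inf > 0" and \<nu>: "\<nu> = nu_P1 \<alpha> d k \<gamma> h\<^sub>0 T_inf"
    and T\<^sub>0: "T\<^sub>0 = 2 * sqrt d * h\<^sub>0 * T_inf * \<nu> * kummer (- \<alpha> / 2 + 1/2) (3/2) (- (\<nu>\<^sup>2)) /
               (k * kummer (- \<alpha> / 2) (1/2) (- (\<nu>\<^sup>2)) +
                2 * sqrt d * h\<^sub>0 * \<nu> * kummer (- \<alpha> / 2 + 1/2) (3/2) (- (\<nu>\<^sup>2)))"
  have front: "\<nu> > 0" "2 * sqrt d * h\<^sub>0 * (T_inf - front_temperature \<alpha> d k \<gamma> \<nu>) =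
      - k * front_gradient \<alpha> d k \<gamma> \<nu>"
    using nu_P1_iff[OF assms data] \<nu> by blast+
  have T\<^sub>0_eq: "T\<^sub>0 = front_temperature \<alpha> d k \<gamma> \<nu>"
    unfolding T\<^sub>0 by (rule convective_coefficients(1)[OF assms(1-3) front(1) data(1) front(2)])
  then have "T\<^sub>0 > 0"
    using front_field_solves_P2[OF assms front(1)] by (simp add: solves_P2_def)
  then have "mu_P2 \<alpha> d k \<gamma> T\<^sub>0 = \<nu>"
    using mu_P2_iff[OF assms] front(1) T\<^sub>0_eq by simp
  note shared = problems_share_front[OF assms data \<open>T\<^sub>0 > 0\<close> \<nu>[symmetric] this]
  show "solves_P1 \<alpha> d k \<gamma> h\<^sub>0 T_inf (Psi_P1 \<alpha> d k \<gamma> h\<^sub>0 T_inf) (s_P1 \<alpha> d k \<gamma> h\<^sub>0 T_inf)"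
      "solves_P2 \<alpha> d k \<gamma> T\<^sub>0 (Theta_P2 \<alpha> d k \<gamma> T\<^sub>0) (r_P2 \<alpha> d k \<gamma> T\<^sub>0)"
    using shared(1,2) .
  show "solutions_coincide (Psi_P1 \<alpha> d k \<gamma> h\<^sub>0 T_inf) (s_P1 \<alpha> d k \<gamma> h\<^sub>0 T_inf)
      (Theta_P2 \<alpha> d k \<gamma> T\<^sub>0) (r_P2 \<alpha> d k \<gamma> T\<^sub>0)"
    by (simp add: solutions_coincide_def shared(3,4))
next
  fix T\<^sub>0 \<mu> T_inf h\<^sub>0 :: real
  assume T\<^sub>0: "T\<^sub>0 > 0" and \<mu>: "\<mu> = mu_P2 \<alpha> d k \<gamma> T\<^sub>0" and T_inf: "T_inf > T\<^sub>0"
    and h\<^sub>0: "h\<^sub>0 = - k * T\<^sub>0 * kummer (- \<alpha> / 2) (1/2) (- (\<mu>\<^sup>2)) /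
               (2 * sqrt d * (T\<^sub>0 - T_inf) * \<mu> * kummer (- \<alpha> / 2 + 1/2) (3/2) (- (\<mu>\<^sup>2)))"
  define A B where "A = kummer (- \<alpha> / 2) (1/2) (- (\<mu>\<^sup>2))"
    and "B = kummer (- \<alpha> / 2 + 1/2) (3/2) (- (\<mu>\<^sup>2))"
  have front: "\<mu> > 0" "T\<^sub>0 = front_temperature \<alpha> d k \<gamma> \<mu>"
    using mu_P2_iff[OF assms T\<^sub>0] \<mu> by blast+
  have AB: "A > 0" "\<mu> * B > 0" "T\<^sub>0 * A = - front_gradient \<alpha> d k \<gamma> \<mu> * (\<mu> * B)"
    unfolding A_def B_def front(2) by (rule front_ratio[OF assms(1) front(1)])+
  \<comment> \<open>With \<open>T\<^sub>0 A = - y'(0) \<mu> B\<close> the factor \<open>\<mu> B\<close> cancels, and the formula for \<open>h\<^sub>0\<close> is the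
    convective condition.\<close>
  define m where "m = \<mu> * B"
  have m: "m > 0"
    using AB(2) by (simp add: m_def)
  have sqrt_d: "sqrt d > 0"
    using assms(2) by simp
  have flip: "2 * sqrt d * (T\<^sub>0 - T_inf) * \<mu> * B = - (2 * sqrt d * (T_inf - T\<^sub>0) * (\<mu> * B))"
    by (simp add: algebra_simps)
  have "h\<^sub>0 = k * (T\<^sub>0 * A) / (2 * sqrt d * (T_inf - T\<^sub>0) * (\<mu> * B))"
    unfolding h\<^sub>0 A_def[symmetric] B_def[symmetric] flip by simp
  then have h\<^sub>0_eq: "h\<^sub>0 = k * (- front_gradient \<alpha> d k \<gamma> \<mu> * m) / (2 * sqrt d * (T_inf - T\<^sub>0) * m)"
    unfolding AB(3) m_def .
  have "h\<^sub>0 > 0"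
    unfolding h\<^sub>0_eq AB(3)[folded m_def, symmetric]
    using AB(1) m T\<^sub>0 T_inf sqrt_d assms(3) by simp
  have balance: "2 * sqrt d * h\<^sub>0 * (T_inf - T\<^sub>0) = - k * front_gradient \<alpha> d k \<gamma> \<mu>"
    unfolding h\<^sub>0_eq using m T_inf sqrt_d by simp
  have "T_inf > 0"
    using T\<^sub>0 T_inf by simp
  have "nu_P1 \<alpha> d k \<gamma> h\<^sub>0 T_inf = \<mu>"
    using nu_P1_iff[OF assms \<open>h\<^sub>0 > 0\<close> \<open>T_inf > 0\<close>] front balance by simp
  note shared = problems_share_front[OF assms \<open>h\<^sub>0 > 0\<close> \<open>T_inf > 0\<close> T\<^sub>0 this \<mu>[symmetric]]
  show "solves_P2 \<alpha> d k \<gamma> T\<^sub>0 (Theta_P2 \<alpha> d k \<gamma> T\<^sub>0) (r_P2 \<alpha> d k \<gamma> T\<^sub>0)"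
      "solves_P1 \<alpha> d k \<gamma> h\<^sub>0 T_inf (Psi_P1 \<alpha> d k \<gamma> h\<^sub>0 T_inf) (s_P1 \<alpha> d k \<gamma> h\<^sub>0 T_inf)"
    using shared(2,1) .
  show "solutions_coincide (Theta_P2 \<alpha> d k \<gamma> T\<^sub>0) (r_P2 \<alpha> d k \<gamma> T\<^sub>0)
      (Psi_P1 \<alpha> d k \<gamma> h\<^sub>0 T_inf) (s_P1 \<alpha> d k \<gamma> h\<^sub>0 T_inf)"
    by (simp add: solutions_coincide_def shared(3,4))
qed

end
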